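(* Let (S) denote the following universally quantified assertion. (S): For every complete metric space $(X,d)$, every point $x_0\in X$, every map $f:X\to X$, every $\alpha\ge 1$, every increasing function $\psi:[0,\infty)\to[0,\infty)$ that is continuous at $0$ with $\psi(0)=0$, every $\Lambda\ge 0$ and every $\beta\in[0,\alpha]$: if $$d(f(x),f(y))\le (1-\varepsilon)\,d(x,y)+\Lambda\,\varepsilon^{\alpha}\,\psi(\varepsilon)\,\bigl[1+d(x,x_0)+d(y,x_0)\bigr]\qquad\text{for all }\varepsilon\in[0,1]\text{ and all }x,y\in X, \quad ( * )$$ then $f$ has a unique fixed point $x^{*}=f(x^{*})$, and there is a constant $C$ with $0\le C\le \Lambda\,(1+4\,d(x^{*},x_0))\,\beta$ such that $d(x^{*},f^{n}(x_0))\le C\,\omega_n(\alpha)$ for every $n\ge 1$, where $\omega_n(\alpha)=\frac{\alpha}{n}\sum_{k=1}^{n}\psi\!\left(\frac{\alpha}{k}\right)$. Assume that (S) is true. Then, whenever $(X,d)$ is a complete metric space, $x_0\in X$, $f:X\to X$, $\alpha\ge 1$, $\psi:[0,\infty)\to[0,\infty)$ is increasing and continuous at $0$ with $\psi(0)=0$, $\Lambda\ge 0$, $\beta\in[0,\alpha]$, and $( * )$ holds for these data, the map $f$ is constant.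
   Context: $f^{n}$ denotes the $n$-th iterate $f\circ\cdots\circ f$ ($n$ times). In $( * )$ and in the bound for $C$, the point $x_0$ is an arbitrarily selected base point of $X$. The assertion (S) is a hypothesis of the result (it is a statement from the literature under examination); in it the bound on $C$ contains $\beta$ as a multiplicative factor (not an exponent), and the bracket in $( * )$ is not raised to the power $\beta$. *)

theory Defs
  imports "HOL-Analysis.Analysis"
begin

text \<open>
  The metric space is a carrier \<open>X\<close> with a distance \<open>d\<close>; the map \<open>f\<close> is a
  HOL-total function of which only the restriction to \<open>X\<close> is relevant. ``Increasing'' is
  read as non-decreasing.
\<close>

definition gauge_function :: "(real \<Rightarrow> real) \<Rightarrow> bool" where
  "gauge_function \<psi> \<longleftrightarrow>
     \<psi> \<in> {0..} \<rightarrow> {0..} \<and> mono_on {0..} \<psi> \<and>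
     continuous (at 0 within {0..}) \<psi> \<and> \<psi> 0 = 0"

text \<open>Since \<open>0 powr \<alpha> = 0\<close>, the term \<open>\<epsilon> powr \<alpha>\<close> has its usual value at \<open>\<epsilon> = 0\<close> too.\<close>

definition pata_condition ::
  "'a set \<Rightarrow> ('a \<Rightarrow> 'a \<Rightarrow> real) \<Rightarrow> 'a \<Rightarrow> ('a \<Rightarrow> 'a) \<Rightarrow> real \<Rightarrow> (real \<Rightarrow> real) \<Rightarrow> real \<Rightarrow> bool" where
  "pata_condition X d x\<^sub>0 f \<alpha> \<psi> \<Lambda> \<longleftrightarrow>
     (\<forall>\<epsilon>\<in>{0..1}. \<forall>x\<in>X. \<forall>y\<in>X.
        d (f x) (f y) \<le> (1 - \<epsilon>) * d x y
          + \<Lambda> * (\<epsilon> powr \<alpha>) * \<psi> \<epsilon> * (1 + d x x\<^sub>0 + d y x\<^sub>0))"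

definition pata_data ::
  "'a set \<Rightarrow> ('a \<Rightarrow> 'a \<Rightarrow> real) \<Rightarrow> 'a \<Rightarrow> ('a \<Rightarrow> 'a) \<Rightarrow> real \<Rightarrow> (real \<Rightarrow> real) \<Rightarrow> real \<Rightarrow> real \<Rightarrow> bool"
  where
  "pata_data X d x\<^sub>0 f \<alpha> \<psi> \<Lambda> \<beta> \<longleftrightarrow>
     Metric_space X d \<and> Metric_space.mcomplete X d \<and> x\<^sub>0 \<in> X \<and> f \<in> X \<rightarrow> X \<and>
     1 \<le> \<alpha> \<and> gauge_function \<psi> \<and> 0 \<le> \<Lambda> \<and> \<beta> \<in> {0..\<alpha>} \<and>
     pata_condition X d x\<^sub>0 f \<alpha> \<psi> \<Lambda>"

definition omega :: "(real \<Rightarrow> real) \<Rightarrow> real \<Rightarrow> nat \<Rightarrow> real" where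
  "omega \<psi> \<alpha> n = (\<alpha> / real n) * (\<Sum>k = 1..n. \<psi> (\<alpha> / real k))"

text \<open>
  HOL cannot quantify over types inside a formula, so the assertion (S) is indexed by the type
  of points and ranges over all metric spaces whose carrier is a set of that type.
\<close>

definition assertion_S :: "'a itself \<Rightarrow> bool" where
  "assertion_S T \<longleftrightarrow>
     (\<forall>(X :: 'a set) d x\<^sub>0 f \<alpha> \<psi> \<Lambda> \<beta>.
        pata_data X d x\<^sub>0 f \<alpha> \<psi> \<Lambda> \<beta> \<longrightarrow>
        (\<exists>xs\<in>X. f xs = xs \<and> (\<forall>y\<in>X. f y = y \<longrightarrow> y = xs) \<and>
           (\<exists>C. 0 \<le> C \<and> C \<le> \<Lambda> * (1 + 4 * d xs x\<^sub>0) * \<beta> \<and>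
              (\<forall>n\<ge>1. d xs ((f ^^ n) x\<^sub>0) \<le> C * omega \<psi> \<alpha> n))))"

end

theory Submission
  imports Defs
begin

text \<open>
  Taking \<open>\<beta> = 0\<close> in (S) forces \<open>C = 0\<close>, so \<open>f\<close> sends the base point to the fixed point in one
  step. Condition (*) survives a change of base point at the price of a larger \<open>\<Lambda>\<close>, so every
  point of \<open>X\<close> may serve as base point, and the fixed point is the same each time by uniqueness.
\<close>

text \<open>The triangle inequality through \<open>x\<^sub>1\<close> enlarges the bracket by at most
  twice the distance between the two base points. Since the new bracket is at least 1, this additive
  loss can be absorbed into a factor, and so into \<Lambda>.\<close>

lemma pata_condition_change_base:
  assumes "Metric_space X d" "x\<^sub>0 \<in> X" "x\<^sub>1 \<in> X" "0 \<le> \<Lambda>" "gauge_function \<psi>"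
    and "pata_condition X d x\<^sub>0 f \<alpha> \<psi> \<Lambda>"
  shows "pata_condition X d x\<^sub>1 f \<alpha> \<psi> (\<Lambda> * (1 + 2 * d x\<^sub>1 x\<^sub>0))"
  unfolding pata_condition_def
proof (intro ballI)
  fix \<epsilon> x y assume \<epsilon>: "\<epsilon> \<in> {0..1::real}" and x: "x \<in> X" and y: "y \<in> X"
  interpret Metric_space X d by fact
  let ?D = "d x\<^sub>1 x\<^sub>0" and ?K = "\<Lambda> * \<epsilon> powr \<alpha> * \<psi> \<epsilon>"
  have "0 \<le> \<psi> \<epsilon>"
    using \<epsilon> \<open>gauge_function \<psi>\<close> by (auto simp: gauge_function_def Pi_iff)
  then have K: "0 \<le> ?K"
    using \<open>0 \<le> \<Lambda>\<close> by simp
  \<comment> \<open>Twice this product is exactly the gap in the second inequality of the chain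
    below.\<close>
  have D: "0 \<le> ?D * (d x x\<^sub>1 + d y x\<^sub>1)"
    by simp
  have "1 + d x x\<^sub>0 + d y x\<^sub>0 \<le> 1 + (d x x\<^sub>1 + ?D) + (d y x\<^sub>1 + ?D)"
    using triangle[OF x \<open>x\<^sub>1 \<in> X\<close> \<open>x\<^sub>0 \<in> X\<close>] triangle[OF y \<open>x\<^sub>1 \<in> X\<close> \<open>x\<^sub>0 \<in> X\<close>] by linarith
  also have "\<dots> \<le> (1 + 2 * ?D) * (1 + d x x\<^sub>1 + d y x\<^sub>1)"
    using D by (simp add: algebra_simps)
  finally have "?K * (1 + d x x\<^sub>0 + d y x\<^sub>0) \<le> ?K * ((1 + 2 * ?D) * (1 + d x x\<^sub>1 + d y x\<^sub>1))"
    using K by (rule mult_left_mono)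
  also have "\<dots> = \<Lambda> * (1 + 2 * ?D) * \<epsilon> powr \<alpha> * \<psi> \<epsilon> * (1 + d x x\<^sub>1 + d y x\<^sub>1)"
    by (simp only: mult_ac)
  finally have "?K * (1 + d x x\<^sub>0 + d y x\<^sub>0)
      \<le> \<Lambda> * (1 + 2 * ?D) * \<epsilon> powr \<alpha> * \<psi> \<epsilon> * (1 + d x x\<^sub>1 + d y x\<^sub>1)" .
  moreover have "d (f x) (f y) \<le> (1 - \<epsilon>) * d x y + ?K * (1 + d x x\<^sub>0 + d y x\<^sub>0)"
    using assms(6) \<epsilon> x y unfolding pata_condition_def by blast
  ultimately show "d (f x) (f y) \<le> (1 - \<epsilon>) * d x y
      + \<Lambda> * (1 + 2 * ?D) * \<epsilon> powr \<alpha> * \<psi> \<epsilon> * (1 + d x x\<^sub>1 + d y x\<^sub>1)"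
    by linarith
qed

text \<open>The condition does not involve \<beta>, so \<beta> may be reset to 0 along with the
  change of base point; 0 is admissible because \<alpha> \<ge> 1.\<close>

lemma pata_data_change_base:
  assumes "pata_data X d x\<^sub>0 f \<alpha> \<psi> \<Lambda> \<beta>" "x\<^sub>1 \<in> X"
  shows "pata_data X d x\<^sub>1 f \<alpha> \<psi> (\<Lambda> * (1 + 2 * d x\<^sub>1 x\<^sub>0)) 0"
proof -
  interpret Metric_space X d using assms(1) by (simp add: pata_data_def)
  show ?thesis
    using assms pata_condition_change_base[of X d x\<^sub>0 x\<^sub>1 \<Lambda> \<psi> f \<alpha>]
    by (auto simp: pata_data_def)
qed

text \<open>The fixed point is expressed as \<open>f x\<^sub>0\<close>, so that the conclusions for
  two base points can be compared directly.\<close>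

lemma assertion_S_fixes_image_of_base:
  fixes X :: "'a set"
  assumes "assertion_S TYPE('a)" "pata_data X d x\<^sub>0 f \<alpha> \<psi> \<Lambda> 0"
  shows "f (f x\<^sub>0) = f x\<^sub>0 \<and> (\<forall>y\<in>X. f y = y \<longrightarrow> y = f x\<^sub>0)"
proof -
  interpret Metric_space X d using assms(2) by (simp add: pata_data_def)
  obtain xs C where xs: "xs \<in> X" "f xs = xs" "\<forall>y\<in>X. f y = y \<longrightarrow> y = xs"
    and C: "0 \<le> C" "C \<le> \<Lambda> * (1 + 4 * d xs x\<^sub>0) * 0"
    and rate: "\<forall>n\<ge>1. d xs ((f ^^ n) x\<^sub>0) \<le> C * omega \<psi> \<alpha> n"
    using assms unfolding assertion_S_def by blast
  have "C = 0" using C by simp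
  \<comment> \<open>At n = 1 the iterate is \<open>f x\<^sub>0\<close> itself, and
    \<open>C = 0\<close> annihilates \<open>omega\<close> whatever its value.\<close>
  then have "d xs (f x\<^sub>0) \<le> 0" using rate[rule_format, of 1] by simp
  moreover have "f x\<^sub>0 \<in> X" using assms(2) by (auto simp: pata_data_def)
  ultimately have "f x\<^sub>0 = xs"
    using xs(1) zero[of xs "f x\<^sub>0"] nonneg[of xs "f x\<^sub>0"] by (metis order_antisym)
  then show ?thesis using xs(2,3) by metis
qed

theorem factB:
  fixes X :: "'a set" and d :: "'a \<Rightarrow> 'a \<Rightarrow> real" and x\<^sub>0 :: 'a and f :: "'a \<Rightarrow> 'a"
    and \<alpha> \<Lambda> \<beta> :: real and \<psi> :: "real \<Rightarrow> real"
  assumes "assertion_S TYPE('a)"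
    and "pata_data X d x\<^sub>0 f \<alpha> \<psi> \<Lambda> \<beta>"
  shows "f constant_on X"
proof -
  have im: "f \<in> X \<rightarrow> X" and x0: "x\<^sub>0 \<in> X"
    using assms(2) by (auto simp: pata_data_def)
  have fix_im: "f (f x) = f x \<and> (\<forall>y\<in>X. f y = y \<longrightarrow> y = f x)" if "x \<in> X" for x
    using assertion_S_fixes_image_of_base[OF assms(1) pata_data_change_base[OF assms(2) that]] .
  \<comment> \<open>With \<open>x\<close> as base point, \<open>f x\<close> is a fixed point in
    \<open>X\<close>; uniqueness obtained from the base point \<open>x\<^sub>0\<close> identifies it
    with \<open>f x\<^sub>0\<close>.\<close>
  have "f x = f x\<^sub>0" if "x \<in> X" for x
    using fix_im[OF that] fix_im[OF x0] im that by blast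
  then show ?thesis unfolding constant_on_def by blast
qed

end
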